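(* Let $\varphi:\mathbb{N}^{\mathbb{N}}\to\mathbb{N}$ be any type two functional. There is no functional $\Theta$ satisfying $\textsf{SFF}(\Theta)$ that is computable in $\varphi$.
   Context: The metatheory is $\textsf{ZFC}$ and functionals live in the full (set-theoretic) type structure over $\mathbb{N}$. "Computable" (in given functionals) means Kleene computable via the schemes S1–S9. For $f\in\mathbb{N}^{\mathbb{N}}$, $\overline{f}N=\langle f(0),\dots,f(N-1)\rangle$; for a finite sequence $\sigma$, $f\in[\sigma]$ means $f$ extends $\sigma$. A functional $\Theta$ of type $2\to1^*$ assigns to every $G:\mathbb{N}^{\mathbb{N}}\to\mathbb{N}$ a finite sequence $\Theta(G)=\langle f_0,\dots,f_k\rangle$ of elements of $\mathbb{N}^{\mathbb{N}}$. $\textsf{SFF}(\Theta)$ ("$\Theta$ is a special fan functional") is the statement: for all $G:\mathbb{N}^{\mathbb{N}}\to\mathbb{N}$ and all $f\in2^{\mathbb{N}}$ there is an entry $g$ of $\Theta(G)$ with $f\in[\overline{g}G(g)]$. That such a $\Theta$ is computable means that the (suitably coded) map giving the length of $\Theta(G)$ and the values $\Theta(G)(i)(n)$ is computable. *)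

theory Defs
  imports Main "HOL-Library.Nat_Bijection" "HOL-Library.Multiset"
begin

text \<open>
  Arguments of Kleene computations, of pure types 0, 1 and 2, over the full set-theoretic type
  structure. In S1--S9 a computation only calls subcomputations whose arguments are arguments of
  the original one or have type at least two lower than some argument (or are numbers). Hence
  computations on arguments of type at most 2 never leave these types, and no higher types are
  needed to speak of a functional of type \<open>2 \<rightarrow> 1\<^sup>*\<close> being computable in a functional of type 2.
\<close>

datatype arg = Num nat | Fun "nat \<Rightarrow> nat" | Fnl "(nat \<Rightarrow> nat) \<Rightarrow> nat"

text \<open>
  \<open>kleene e as v\<close> means that \<open>{e}(as)\<close> is defined and has value \<open>v\<close>. Indices are natural numbers
  coding lists, as S9 requires: it uses a numerical argument as an index. In S6 the list \<open>p\<close> is a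
  permutation of the argument positions. In S8 the functional \<open>F\<close> is applied only when
  \<open>{d}(x, F, as)\<close> is defined for every \<open>x\<close>.
\<close>

inductive kleene :: "nat \<Rightarrow> arg list \<Rightarrow> nat \<Rightarrow> bool" where
  S1: "kleene (list_encode [1]) (Num x # as) (Suc x)"
| S2: "kleene (list_encode [2, q]) as q"
| S3: "kleene (list_encode [3]) (Num x # as) x"
| S4: "kleene d as u \<Longrightarrow> kleene c (Num u # as) v \<Longrightarrow> kleene (list_encode [4, c, d]) as v"
| S5_0: "kleene c as v \<Longrightarrow> kleene (list_encode [5, c, d]) (Num 0 # as) v"
| S5_Suc: "kleene (list_encode [5, c, d]) (Num x # as) u \<Longrightarrow> kleene d (Num x # Num u # as) v \<Longrightarrow>
    kleene (list_encode [5, c, d]) (Num (Suc x) # as) v"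
| S6: "mset p = mset [0..<length as] \<Longrightarrow> kleene d (map (\<lambda>i. as ! i) p) v \<Longrightarrow>
    kleene (list_encode (6 # d # p)) as v"
| S7: "kleene (list_encode [7]) (Fun f # Num x # as) (f x)"
| S8: "(\<And>x. kleene d (Num x # Fnl F # as) (f x)) \<Longrightarrow>
    kleene (list_encode [8, d]) (Fnl F # as) (F f)"
| S9: "kleene x as v \<Longrightarrow> kleene (list_encode [9, length as]) (Num x # as @ bs) v"

lemma kleene_deterministic: "kleene e as v \<Longrightarrow> kleene e as w \<Longrightarrow> v = w"
proof (induction arbitrary: w rule: kleene.induct)
  case (S1 x as)
  then show ?case by (cases rule: kleene.cases) (simp_all del: list_encode.simps add: list_encode_eq)
next
  case (S2 q as)
  then show ?case by (cases rule: kleene.cases) (simp_all del: list_encode.simps add: list_encode_eq)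
next
  case (S3 x as)
  then show ?case by (cases rule: kleene.cases) (simp_all del: list_encode.simps add: list_encode_eq)
next
  case (S4 d as u c v)
  from S4.prems obtain u' where "kleene d as u'" "kleene c (Num u' # as) w"
    by (cases rule: kleene.cases) (simp_all del: list_encode.simps add: list_encode_eq)
  with S4.IH show ?case by blast
next
  case (S5_0 c as v d)
  from S5_0.prems have "kleene c as w"
    by (cases rule: kleene.cases) (simp_all del: list_encode.simps add: list_encode_eq)
  with S5_0.IH show ?case by blast
next
  case (S5_Suc c d x as u v)
  from S5_Suc.prems obtain u' where
    "kleene (list_encode [5, c, d]) (Num x # as) u'" "kleene d (Num x # Num u' # as) w"
    by (cases rule: kleene.cases) (simp_all del: list_encode.simps add: list_encode_eq)
  with S5_Suc.IH show ?case by blast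
next
  case (S6 p as d v)
  from S6.prems have "kleene d (map (\<lambda>i. as ! i) p) w"
    by (cases rule: kleene.cases) (simp_all del: list_encode.simps add: list_encode_eq)
  with S6.IH show ?case by blast
next
  case (S7 f x as)
  then show ?case by (cases rule: kleene.cases) (simp_all del: list_encode.simps add: list_encode_eq)
next
  case (S8 d F as f)
  from S8.prems obtain g where g: "w = F g" "\<And>x. kleene d (Num x # Fnl F # as) (g x)"
    by (cases rule: kleene.cases) (simp_all del: list_encode.simps add: list_encode_eq)
  from S8.IH g(2) have "f = g" by blast
  with g(1) show ?case by simp
next
  case (S9 x as v bs)
  from S9.prems have "kleene x as w"
    by (cases rule: kleene.cases) (simp_all del: list_encode.simps add: list_encode_eq)
  with S9.IH show ?case by blast
qed

type_synonym fan_type = "((nat \<Rightarrow> nat) \<Rightarrow> nat) \<Rightarrow> (nat \<Rightarrow> nat) list"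

definition initseg :: "(nat \<Rightarrow> nat) \<Rightarrow> nat \<Rightarrow> nat list" where
  "initseg f N = map f [0..<N]"

definition cylinder :: "nat list \<Rightarrow> (nat \<Rightarrow> nat) set" where
  "cylinder \<sigma> = {f. initseg f (length \<sigma>) = \<sigma>}"

definition SFF :: "fan_type \<Rightarrow> bool" where
  "SFF \<Theta> \<longleftrightarrow> (\<forall>G f. range f \<subseteq> {0, 1} \<longrightarrow> (\<exists>g \<in> set (\<Theta> G). f \<in> cylinder (initseg g (G g))))"

text \<open>
  The values are only required where they exist, that is, at positions of the sequence \<open>\<Theta> G\<close>.
\<close>

definition computable_in :: "((nat \<Rightarrow> nat) \<Rightarrow> nat) \<Rightarrow> fan_type \<Rightarrow> bool" where
  "computable_in \<phi> \<Theta> \<longleftrightarrow>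
    (\<exists>d. \<forall>G. kleene d [Fnl G, Fnl \<phi>] (length (\<Theta> G))) \<and>
    (\<exists>e. \<forall>G i n. i < length (\<Theta> G) \<longrightarrow> kleene e [Num i, Num n, Fnl G, Fnl \<phi>] ((\<Theta> G ! i) n))"

end

theory Submission
  imports Defs "HOL-Library.Countable"
begin

text \<open>
  Enumerate, injectively by indices, the functions that are computable from \<open>\<phi>\<close> together with this
  very enumeration. More precisely, Zorn's lemma gives a maximal partial functional \<open>P\<close> that sends
  each function of its domain to an index of it, where an index \<open>c\<close> of \<open>f\<close> computes \<open>f\<close> from \<open>\<phi>\<close> and
  every total extension \<open>G\<close> of \<open>P\<close>. By maximality a computation from \<open>G\<close> and \<open>\<phi>\<close> applies \<open>G\<close> only to
  functions in the domain of \<open>P\<close>, and all functions that it computes lie in this domain. In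
  particular this holds for the entries of \<open>\<Theta> G\<close>. With \<open>G f = c + 1\<close> for \<open>(f, c) \<in> P\<close>, the
  neighbourhood of the function with index \<open>c\<close> fixes its value at \<open>c\<close>, so that diagonalization yields
  a binary function outside all these neighbourhoods.
\<close>

text \<open>
  Argument lists built from numbers, \<open>G\<close> and \<open>\<phi>\<close> are represented by templates in which \<open>Inr True\<close>
  marks the places of \<open>G\<close> and \<open>Inr False\<close> those of \<open>\<phi>\<close>: this keeps the two apart even if \<open>G = \<phi>\<close>.
\<close>

type_synonym template = "nat + bool"

fun inst :: "((nat \<Rightarrow> nat) \<Rightarrow> nat) \<Rightarrow> ((nat \<Rightarrow> nat) \<Rightarrow> nat) \<Rightarrow> template \<Rightarrow> arg" where
  "inst \<phi> G (Inl n) = Num n"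
| "inst \<phi> G (Inr b) = Fnl (if b then G else \<phi>)"

lemma inst_eq_Num_iff: "Num n = inst \<phi> G t \<longleftrightarrow> t = Inl n"
  by (cases t) auto

lemma inst_neq_Fun: "Fun f \<noteq> inst \<phi> G t"
  by (cases t) auto

lemma inst_eq_FnlE:
  assumes "Fnl F = inst \<phi> G t"
  obtains b where "t = Inr b" "F = (if b then G else \<phi>)"
  using assms by (cases t) auto

definition extends :: "((nat \<Rightarrow> nat) \<times> nat) set \<Rightarrow> ((nat \<Rightarrow> nat) \<Rightarrow> nat) \<Rightarrow> bool" where
  "extends P G \<longleftrightarrow> (\<forall>(f, c) \<in> P. G f = Suc c)"

text \<open>The number \<open>c\<close> codes a program \<open>e\<close> together with the arguments
  \<open>ts\<close> after \<open>x\<close>, because S8 forms functions from computations with such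
  parameters. Quantifying over all extensions makes an index independent of the choice of
  \<open>G\<close>.\<close>

definition has_index ::
  "((nat \<Rightarrow> nat) \<Rightarrow> nat) \<Rightarrow> ((nat \<Rightarrow> nat) \<times> nat) set \<Rightarrow> nat \<Rightarrow> (nat \<Rightarrow> nat) \<Rightarrow> bool" where
  "has_index \<phi> P c f \<longleftrightarrow>
    (case from_nat c :: nat \<times> template list of
      (e, ts) \<Rightarrow> \<forall>G x. extends P G \<longrightarrow> kleene e (Num x # map (inst \<phi> G) ts) (f x))"

definition enumeration :: "((nat \<Rightarrow> nat) \<Rightarrow> nat) \<Rightarrow> ((nat \<Rightarrow> nat) \<times> nat) set \<Rightarrow> bool" where
  "enumeration \<phi> P \<longleftrightarrow> single_valued P \<and> (\<forall>(f, c) \<in> P. has_index \<phi> P c f)"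

text \<open>\<open>Domain P\<close> rather than \<open>P\<close>: a function may have many indices,
  of which an enumeration keeps one.\<close>

definition closed :: "((nat \<Rightarrow> nat) \<Rightarrow> nat) \<Rightarrow> ((nat \<Rightarrow> nat) \<times> nat) set \<Rightarrow> bool" where
  "closed \<phi> P \<longleftrightarrow> (\<forall>c f. has_index \<phi> P c f \<longrightarrow> f \<in> Domain P)"

lemma extends_antimono: "P \<subseteq> Q \<Longrightarrow> extends Q G \<Longrightarrow> extends P G"
  unfolding extends_def by blast

text \<open>Every extension of \<open>Q\<close> also extends \<open>P\<close>, so \<open>Q\<close>
  leaves less to check.\<close>

lemma has_index_mono: "has_index \<phi> P c f \<Longrightarrow> P \<subseteq> Q \<Longrightarrow> has_index \<phi> Q c f"
  unfolding has_index_def by (auto dest: extends_antimono)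

text \<open>If \<open>P\<close> had no extension, every number would vacuously be an index of every
  function; \<open>G\<close> rules this out.\<close>

lemma has_index_unique:
  assumes "has_index \<phi> P c f" "has_index \<phi> P c g" "extends P G"
  shows "f = g"
proof
  fix x
  obtain e ts where "(from_nat c :: nat \<times> template list) = (e, ts)" by fastforce
  with assms have "kleene e (Num x # map (inst \<phi> G) ts) (f x)"
    "kleene e (Num x # map (inst \<phi> G) ts) (g x)"
    unfolding has_index_def by auto
  then show "f x = g x" by (rule kleene_deterministic)
qed

lemma extends_exists:
  assumes "single_valued P"
  obtains G where "extends P G"
proof
  have "(SOME c. (f, c) \<in> P) = c" if "(f, c) \<in> P" for f c
    using that assms by (metis single_valuedD someI)
  then show "extends P (\<lambda>f. Suc (SOME c. (f, c) \<in> P))"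
    unfolding extends_def by auto
qed

lemma enumeration_Union:
  assumes "subset.chain {P. enumeration \<phi> P} \<C>"
  shows "enumeration \<phi> (\<Union>\<C>)"
proof -
  have en: "enumeration \<phi> P" if "P \<in> \<C>" for P
    using assms that unfolding subset.chain_def by blast
  have "single_valued (\<Union>\<C>)"
  proof (rule single_valuedI)
    fix f c d assume "(f, c) \<in> \<Union>\<C>" "(f, d) \<in> \<Union>\<C>"
    then obtain P Q where "P \<in> \<C>" "Q \<in> \<C>" "(f, c) \<in> P" "(f, d) \<in> Q" by blast
    moreover from this have "P \<subseteq> Q \<or> Q \<subseteq> P"
      using assms unfolding subset_chain_def by blast
    ultimately show "c = d"
      using en unfolding enumeration_def by (metis single_valuedD subsetD)
  qed
  moreover have "has_index \<phi> (\<Union>\<C>) c f" if "(f, c) \<in> \<Union>\<C>" for f c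
  proof -
    from that obtain P where "P \<in> \<C>" "(f, c) \<in> P" by blast
    with en have "has_index \<phi> P c f" unfolding enumeration_def by blast
    then show ?thesis using \<open>P \<in> \<C>\<close> by (rule has_index_mono[OF _ Union_upper])
  qed
  ultimately show ?thesis unfolding enumeration_def by blast
qed

lemma closed_enumeration_exists:
  obtains P where "enumeration \<phi> P" "closed \<phi> P"
proof -
  obtain P where P: "enumeration \<phi> P" and max: "\<And>Q. enumeration \<phi> Q \<Longrightarrow> P \<subseteq> Q \<Longrightarrow> Q = P"
    using subset_Zorn'[of "{P. enumeration \<phi> P}"] enumeration_Union by auto
  have "f \<in> Domain P" if "has_index \<phi> P c f" for c f
  proof (rule ccontr)
    assume new: "f \<notin> Domain P"
    \<comment> \<open>Old indices survive by monotonicity, and a new \<open>f\<close> keeps the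
      relation single-valued.\<close>
    have "enumeration \<phi> (insert (f, c) P)"
      using P that new has_index_mono[OF _ subset_insertI]
      unfolding enumeration_def single_valued_def by blast
    from max[OF this] new show False by blast
  qed
  with P show ?thesis using that unfolding closed_def by blast
qed

text \<open>Only S8 consults \<open>G\<close>, and closedness confines this to arguments in
  \<open>Domain P\<close>, where all extensions agree.\<close>

lemma kleene_transfer:
  assumes "closed \<phi> P" "extends P G"
    and "kleene e (map (inst \<phi> G) ts) v" "extends P H"
  shows "kleene e (map (inst \<phi> H) ts) v"
  using assms(3,4)
proof (induction e "map (inst \<phi> G) ts" v arbitrary: ts H rule: kleene.induct)
  case (S1 x as)
  then obtain us where "ts = Inl x # us"
    by (auto simp: Cons_eq_map_conv inst_eq_Num_iff)
  with kleene.S1 show ?case by (simp del: list_encode.simps)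
next
  case (S2 q)
  show ?case by (rule kleene.S2)
next
  case (S3 x as)
  then obtain us where "ts = Inl x # us"
    by (auto simp: Cons_eq_map_conv inst_eq_Num_iff)
  with kleene.S3 show ?case by (simp del: list_encode.simps)
next
  case (S4 d u c v)
  show ?case
    using S4(2)[OF refl S4.prems] S4(4)[of "Inl u # ts" H] S4.prems
    by (intro kleene.S4) simp_all
next
  case (S5_0 c as v d)
  then obtain us where "ts = Inl 0 # us" "as = map (inst \<phi> G) us"
    by (auto simp: Cons_eq_map_conv inst_eq_Num_iff)
  with kleene.S5_0[OF S5_0(2)[OF _ S5_0.prems]] show ?case
    by (simp del: list_encode.simps)
next
  case (S5_Suc c d x as u v)
  then obtain us where us: "ts = Inl (Suc x) # us" "as = map (inst \<phi> G) us"
    by (auto simp: Cons_eq_map_conv inst_eq_Num_iff)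
  have "kleene (list_encode [5, c, d]) (Num x # map (inst \<phi> H) us) u"
    using S5_Suc(2)[of "Inl x # us" H] S5_Suc.prems us by (simp del: list_encode.simps)
  moreover have "kleene d (Num x # Num u # map (inst \<phi> H) us) v"
    using S5_Suc(4)[of "Inl x # Inl u # us" H] S5_Suc.prems us by simp
  ultimately have "kleene (list_encode [5, c, d]) (Num (Suc x) # map (inst \<phi> H) us) v"
    by (rule kleene.S5_Suc)
  with us show ?case by (simp del: list_encode.simps)
next
  case (S6 p d v)
  have "set p = {..<length ts}"
    using mset_eq_setD[OF S6(1)] by (simp add: atLeast_upt)
  then have eq: "map (\<lambda>i. map (inst \<phi> K) ts ! i) p = map (inst \<phi> K) (map (\<lambda>i. ts ! i) p)" for K
    by simp
  have "mset p = mset [0..<length (map (inst \<phi> H) ts)]"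
    using S6(1) by simp
  moreover have "kleene d (map (\<lambda>i. map (inst \<phi> H) ts ! i) p) v"
    unfolding eq by (rule S6(3)[OF eq S6.prems])
  ultimately show ?case by (rule kleene.S6)
next
  case (S7 f x as)
  then show ?case by (auto simp: Cons_eq_map_conv inst_neq_Fun)
next
  case (S8 d F as f)
  then obtain b us where us: "ts = Inr b # us" "F = (if b then G else \<phi>)" "as = map (inst \<phi> G) us"
    by (auto simp: Cons_eq_map_conv elim!: inst_eq_FnlE)
  \<comment> \<open>The induction hypothesis is needed for all extensions \<open>K\<close>, not just
    \<open>H\<close>: this uniformity is what gives \<open>f\<close> an index.\<close>
  have sub: "kleene d (Num x # Fnl (if b then K else \<phi>) # map (inst \<phi> K) us) (f x)"
    if "extends P K" for K x
    using S8(2)[of x "Inl x # Inr b # us" K] that us by simp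
  then have "has_index \<phi> P (to_nat (d, Inr b # us :: template list)) f"
    by (simp add: has_index_def)
  then obtain c where "(f, c) \<in> P"
    using assms(1) unfolding closed_def by blast
  then have "G f = H f"
    using assms(2) S8.prems unfolding extends_def by fastforce
  then have "F f = (if b then H else \<phi>) f" using us by simp
  with kleene.S8[OF sub[OF S8.prems]] us show ?case
    by (simp del: list_encode.simps)
next
  case (S9 x as v bs)
  then obtain us ws where
    us: "ts = Inl x # us @ ws" "as = map (inst \<phi> G) us" "bs = map (inst \<phi> G) ws"
    by (auto simp: Cons_eq_map_conv inst_eq_Num_iff append_eq_map_conv)
  then show ?case
    using kleene.S9[OF S9(2)[OF us(2) S9.prems], of "map (inst \<phi> H) ws"]
    by (simp del: list_encode.simps)
qed

lemma computed_in_Domain: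
  assumes "closed \<phi> P" "extends P G"
    and "\<And>n. kleene e [Num i, Num n, Fnl G, Fnl \<phi>] (f n)"
  shows "f \<in> Domain P"
proof -
  \<comment> \<open>S6 swaps the first two arguments: an index expects \<open>n\<close> in front,
    and \<open>i\<close> becomes one of its parameters.\<close>
  let ?d = "list_encode (6 # e # [1, 0, 2, 3])"
  let ?ts = "[Inl i, Inr True, Inr False] :: template list"
  have "kleene ?d (map (inst \<phi> G) (Inl n # ?ts)) (f n)" for n
    by (rule kleene.S6) (use assms(3)[of n] in \<open>simp_all add: numeral_2_eq_2 numeral_3_eq_3\<close>)
  then have "kleene ?d (Num n # map (inst \<phi> H) ?ts) (f n)" if "extends P H" for H n
    using kleene_transfer[OF assms(1,2) _ that] by fastforce
  then have "has_index \<phi> P (to_nat (?d, ?ts)) f"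
    by (simp add: has_index_def del: list_encode.simps)
  with assms(1) show ?thesis unfolding closed_def by blast
qed

lemma cylinder_initseg_Suc: "f \<in> cylinder (initseg g (Suc n)) \<Longrightarrow> f n = g n"
  by (simp add: cylinder_def initseg_def)

lemma enumeration_misses_binary:
  assumes "enumeration \<phi> P" "extends P G"
  obtains f where "range f \<subseteq> {0, 1 :: nat}" "\<And>g. g \<in> Domain P \<Longrightarrow> f \<notin> cylinder (initseg g (G g))"
proof
  \<comment> \<open>At \<open>c\<close> this differs from the value at \<open>c\<close> of the
    function enumerated with index \<open>c\<close>, if there is one.\<close>
  let ?f = "\<lambda>c. if \<exists>g. (g, c) \<in> P \<and> g c = 0 then 1 else 0 :: nat"
  show "range ?f \<subseteq> {0, 1}" by auto
  show "?f \<notin> cylinder (initseg g (G g))" if dom: "g \<in> Domain P" for g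
  proof
    assume mem: "?f \<in> cylinder (initseg g (G g))"
    from dom obtain c where c: "(g, c) \<in> P" by blast
    then have "G g = Suc c" using assms(2) unfolding extends_def by blast
    with mem have "?f c = g c" using cylinder_initseg_Suc[of ?f g c] by simp
    \<comment> \<open>An index determines its function, so the existential in \<open>?f c\<close>
      can only be witnessed by \<open>g\<close>.\<close>
    moreover have "h = g" if "(h, c) \<in> P" for h
      using has_index_unique[OF _ _ assms(2)] assms(1) c that unfolding enumeration_def by blast
    then have "(\<exists>h. (h, c) \<in> P \<and> h c = 0) \<longleftrightarrow> g c = 0" using c by blast
    ultimately show False by (simp split: if_splits)
  qed
qed

theorem corollary3p8:
  fixes \<phi> :: "(nat \<Rightarrow> nat) \<Rightarrow> nat"
  shows "\<not> (\<exists>\<Theta>. SFF \<Theta> \<and> computable_in \<phi> \<Theta>)"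
proof
  assume "\<exists>\<Theta>. SFF \<Theta> \<and> computable_in \<phi> \<Theta>"
  then obtain \<Theta> e where sff: "SFF \<Theta>"
    and e: "\<And>G i n. i < length (\<Theta> G) \<Longrightarrow> kleene e [Num i, Num n, Fnl G, Fnl \<phi>] ((\<Theta> G ! i) n)"
    unfolding computable_in_def by blast
  obtain P where P: "enumeration \<phi> P" "closed \<phi> P"
    by (rule closed_enumeration_exists)
  obtain G where G: "extends P G"
    using P(1) extends_exists unfolding enumeration_def by blast
  have "set (\<Theta> G) \<subseteq> Domain P"
    using computed_in_Domain[OF P(2) G e] by (auto simp: in_set_conv_nth)
  moreover obtain f where f: "range f \<subseteq> {0, 1}"
    and "\<And>g. g \<in> Domain P \<Longrightarrow> f \<notin> cylinder (initseg g (G g))"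
    by (rule enumeration_misses_binary[OF P(1) G]) (rule that)
  moreover obtain g where "g \<in> set (\<Theta> G)" "f \<in> cylinder (initseg g (G g))"
    using sff f unfolding SFF_def by metis
  ultimately show False by blast
qed

end
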